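(* Let $q$ be a prime power with $q \equiv 3 \pmod 4$. Then there exists a $4$-uniform hypergraph $\mathcal{H}_q$ on $q+1$ vertices which is a $3$-$(q+1,4,\frac{q+1}{4})$ design and has the following properties: (a) every set of $5$ vertices spans either $0$ or exactly $2$ hyperedges; (b) $\mathcal{H}_q$ has exactly $\frac{q+1}{16}\binom{q+1}{3}$ hyperedges; (c) $\mathcal{H}_q$ is $3$-transitive, and its automorphism group has a subgroup isomorphic to $PGL(2,q)$.
   Context: A set $X$ of vertices spans a hyperedge $A$ if $A \subseteq X$. A $3$-$(v,4,\lambda)$ design is a $4$-uniform hypergraph on $v$ vertices in which every set of $3$ vertices is contained in exactly $\lambda$ hyperedges. A hypergraph is $3$-transitive if its automorphism group acts transitively on ordered triples of distinct vertices. *)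

theory Defs
  imports "HOL-Algebra.Bij" "HOL-Algebra.Coset" "HOL-Algebra.Ring" "HOL-Number_Theory.Prime_Powers" "HOL.Real"
begin

section \<open>Hypergraphs and designs\<close>

text \<open>A hypergraph is given by its vertex set \<open>V\<close> and its set of hyperedges \<open>E\<close>.\<close>

definition uniform_hypergraph :: "nat \<Rightarrow> 'v set \<Rightarrow> 'v set set \<Rightarrow> bool" where
  "uniform_hypergraph k V E \<longleftrightarrow> finite V \<and> (\<forall>A\<in>E. A \<subseteq> V \<and> card A = k)"

definition spanned_hyperedges :: "'v set set \<Rightarrow> 'v set \<Rightarrow> 'v set set" where
  "spanned_hyperedges E S = {A \<in> E. A \<subseteq> S}"

definition design :: "nat \<Rightarrow> nat \<Rightarrow> nat \<Rightarrow> nat \<Rightarrow> 'v set \<Rightarrow> 'v set set \<Rightarrow> bool" where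
  "design t v k l V E \<longleftrightarrow>
     uniform_hypergraph k V E \<and> card V = v \<and>
     (\<forall>T. T \<subseteq> V \<and> card T = t \<longrightarrow> card {A \<in> E. T \<subseteq> A} = l)"

text \<open>Following \<^const>\<open>BijGroup\<close>, an automorphism is a permutation of \<open>V\<close> represented
  by a function that is \<^const>\<open>undefined\<close> outside \<open>V\<close>.\<close>

definition hypergraph_auts :: "'v set \<Rightarrow> 'v set set \<Rightarrow> ('v \<Rightarrow> 'v) set" where
  "hypergraph_auts V E = {f \<in> Bij V. \<forall>A. A \<subseteq> V \<longrightarrow> (f ` A \<in> E \<longleftrightarrow> A \<in> E)}"

definition hypergraph_aut_group :: "'v set \<Rightarrow> 'v set set \<Rightarrow> ('v \<Rightarrow> 'v) monoid" where
  "hypergraph_aut_group V E = (BijGroup V) \<lparr>carrier := hypergraph_auts V E\<rparr>"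

definition three_transitive :: "'v set \<Rightarrow> 'v set set \<Rightarrow> bool" where
  "three_transitive V E \<longleftrightarrow>
     (\<forall>x1\<in>V. \<forall>x2\<in>V. \<forall>x3\<in>V. \<forall>y1\<in>V. \<forall>y2\<in>V. \<forall>y3\<in>V.
        distinct [x1, x2, x3] \<and> distinct [y1, y2, y3] \<longrightarrow>
        (\<exists>f\<in>hypergraph_auts V E. f x1 = y1 \<and> f x2 = y2 \<and> f x3 = y3))"

lemma subgroup_hypergraph_auts: "subgroup (hypergraph_auts V E) (BijGroup V)"
proof (rule group.subgroupI[OF group_BijGroup])
  show "hypergraph_auts V E \<subseteq> carrier (BijGroup V)"
    by (auto simp: hypergraph_auts_def BijGroup_def)
  have "(\<lambda>x\<in>V. x) ` A = A" if "A \<subseteq> V" for A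
    using that by force
  then have "(\<lambda>x\<in>V. x) \<in> hypergraph_auts V E"
    by (simp add: hypergraph_auts_def id_Bij)
  then show "hypergraph_auts V E \<noteq> {}" by blast
next
  fix f assume f: "f \<in> hypergraph_auts V E"
  then have fB: "f \<in> Bij V" by (simp add: hypergraph_auts_def)
  then have bij: "bij_betw f V V" by (simp add: Bij_def)
  have "restrict (inv_into V f) V ` A \<in> E \<longleftrightarrow> A \<in> E" if A: "A \<subseteq> V" for A
  proof -
    let ?B = "restrict (inv_into V f) V ` A"
    have B: "?B = inv_into V f ` A" using A by (auto simp: subset_iff)
    have "inv_into V f ` A \<subseteq> inv_into V f ` V" using A by (rule image_mono)
    also have "\<dots> = V" using bij_betw_inv_into[OF bij] by (simp add: bij_betw_def)
    finally have BV: "?B \<subseteq> V" unfolding B .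
    have "f ` V = V" using bij by (simp add: bij_betw_def)
    then have fB: "f ` ?B = A"
      unfolding B using A by (rule image_inv_into_cancel)
    have "f ` ?B \<in> E \<longleftrightarrow> ?B \<in> E"
      using f BV unfolding hypergraph_auts_def by blast
    then show ?thesis unfolding fB by simp
  qed
  then show "inv\<^bsub>BijGroup V\<^esub> f \<in> hypergraph_auts V E"
    by (simp add: hypergraph_auts_def inv_BijGroup fB restrict_inv_into_Bij)
next
  fix f g assume f: "f \<in> hypergraph_auts V E" and g: "g \<in> hypergraph_auts V E"
  have "compose V f g ` A \<in> E \<longleftrightarrow> A \<in> E" if A: "A \<subseteq> V" for A
  proof -
    have "compose V f g ` A = f ` g ` A" using A by (force simp: compose_def)
    moreover have "g ` A \<subseteq> V"
      using g A Bij_imp_funcset[of g V] unfolding hypergraph_auts_def by blast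
    ultimately show ?thesis using f g A by (simp add: hypergraph_auts_def)
  qed
  then show "f \<otimes>\<^bsub>BijGroup V\<^esub> g \<in> hypergraph_auts V E"
    using f g by (simp add: hypergraph_auts_def BijGroup_def compose_Bij)
qed

lemma group_hypergraph_aut_group: "group (hypergraph_aut_group V E)"
  unfolding hypergraph_aut_group_def
  by (rule subgroup.subgroup_is_group[OF subgroup_hypergraph_auts group_BijGroup])


section \<open>The projective general linear group of degree two\<close>

text \<open>The quadruple \<open>(a, b, c, d)\<close> is the matrix with rows \<open>(a, b)\<close> and \<open>(c, d)\<close>.\<close>

type_synonym 'a mat2 = "'a \<times> 'a \<times> 'a \<times> 'a"

definition mat2_mult :: "('a, 'm) ring_scheme \<Rightarrow> 'a mat2 \<Rightarrow> 'a mat2 \<Rightarrow> 'a mat2" where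
  "mat2_mult F = (\<lambda>(a, b, c, d) (a', b', c', d').
     (a \<otimes>\<^bsub>F\<^esub> a' \<oplus>\<^bsub>F\<^esub> b \<otimes>\<^bsub>F\<^esub> c', a \<otimes>\<^bsub>F\<^esub> b' \<oplus>\<^bsub>F\<^esub> b \<otimes>\<^bsub>F\<^esub> d',
      c \<otimes>\<^bsub>F\<^esub> a' \<oplus>\<^bsub>F\<^esub> d \<otimes>\<^bsub>F\<^esub> c', c \<otimes>\<^bsub>F\<^esub> b' \<oplus>\<^bsub>F\<^esub> d \<otimes>\<^bsub>F\<^esub> d'))"

definition mat2_det :: "('a, 'm) ring_scheme \<Rightarrow> 'a mat2 \<Rightarrow> 'a" where
  "mat2_det F = (\<lambda>(a, b, c, d). a \<otimes>\<^bsub>F\<^esub> d \<ominus>\<^bsub>F\<^esub> b \<otimes>\<^bsub>F\<^esub> c)"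

definition GL2 :: "('a, 'm) ring_scheme \<Rightarrow> 'a mat2 monoid" where
  "GL2 F =
     \<lparr>carrier = {M \<in> carrier F \<times> carrier F \<times> carrier F \<times> carrier F. mat2_det F M \<noteq> \<zero>\<^bsub>F\<^esub>},
      monoid.mult = mat2_mult F,
      one = (\<one>\<^bsub>F\<^esub>, \<zero>\<^bsub>F\<^esub>, \<zero>\<^bsub>F\<^esub>, \<one>\<^bsub>F\<^esub>)\<rparr>"

definition scalar_mats2 :: "('a, 'm) ring_scheme \<Rightarrow> 'a mat2 set" where
  "scalar_mats2 F = {(a, \<zero>\<^bsub>F\<^esub>, \<zero>\<^bsub>F\<^esub>, a) | a. a \<in> carrier F - {\<zero>\<^bsub>F\<^esub>}}"

definition PGL2 :: "('a, 'm) ring_scheme \<Rightarrow> 'a mat2 set monoid" where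
  "PGL2 F = GL2 F Mod scalar_mats2 F"

text \<open>A field with \<open>q\<close> elements is unique up to isomorphism, so \<open>PGL(2,q)\<close> is \<open>PGL2 F\<close> for any
  such field \<open>F\<close>; the carrier being finite, it can be taken to consist of natural numbers.
  Asking for a witness \<open>F\<close>, instead of quantifying over all of them, also asserts that \<open>F\<close> exists.\<close>

definition has_subgroup_iso_PGL2 :: "('g, 'm) monoid_scheme \<Rightarrow> nat \<Rightarrow> bool" where
  "has_subgroup_iso_PGL2 G q \<longleftrightarrow>
     (\<exists>F :: nat ring. field F \<and> finite (carrier F) \<and> card (carrier F) = q \<and>
        (\<exists>K. subgroup K G \<and> G \<lparr>carrier := K\<rparr> \<cong> PGL2 F))"

end

(*
  Let F be a field with q elements and represent the points of its projective line by the vectors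
  (x, 1) and (1, 0). As q = 3 (mod 4), -1 is not a square, so [x y] := det (x, y) being a square
  defines a tournament on the points. A 4-set is a hyperedge iff the three terms [wx][yz], [wy][zx],
  [wz][xy] of the Pluecker relation have the same quadratic character. Replacing a vector by a
  multiple multiplies all three characters by the same sign, and so does a matrix, by the square
  of the character of its determinant; hence PGL(2,q) acts by automorphisms, transitively on ordered
  triples. That 5 points span 0 or 2 hyperedges holds in every tournament. The number of hyperedges
  on a triple need only be counted for (oo, 0, 1), where it is the number of x such that x and 1 - x
  are both nonsquares.
*)

theory Submission
  imports "HOL-Algebra.Algebraic_Closure" "HOL-Algebra.Multiplicative_Group"
    "HOL-Number_Theory.Residues" Defs
begin

section \<open>Existence of finite fields\<close>

lemma (in cring) binomial:
  assumes x: "x \<in> carrier R" and y: "y \<in> carrier R"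
  shows "(x \<oplus> y) [^] (n::nat) = (\<Oplus>k\<in>{..n}. [(n choose k)] \<cdot> (x [^] k \<otimes> y [^] (n - k)))"
proof (induction n)
  case 0
  then show ?case using x y by simp
next
  case (Suc n)
  let ?t = "\<lambda>m k. [(m choose k)] \<cdot> (x [^] k \<otimes> y [^] (m - k))"
  let ?S = "\<Oplus>k\<in>{..n}. ?t n k"
  let ?b = "\<lambda>k. [(n choose k)] \<cdot> (x [^] k \<otimes> y [^] (Suc n - k))"
  have Sx: "?S \<otimes> x = (\<Oplus>k\<in>{..n}. [(n choose k)] \<cdot> (x [^] Suc k \<otimes> y [^] (n - k)))"
    using x y by (subst finsum_ldistr) (auto intro!: finsum_cong' simp: add_pow_ldistr add_pow_rdistr m_ac)
  have Sy: "?S \<otimes> y = (\<Oplus>k\<in>{..n}. ?b k)"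
    using x y by (subst finsum_ldistr)
      (auto intro!: finsum_cong' simp: add_pow_ldistr add_pow_rdistr m_ac Suc_diff_le)
  \<comment> \<open>The added term \<open>k = Suc n\<close> has binomial coefficient 0. Over
    \<open>{..Suc n}\<close> the term \<open>k = 0\<close> can be split off and the rest shifted,
    which is the form that Pascal's rule produces.\<close>
  have b: "(\<Oplus>k\<in>{..n}. ?b k) = (\<Oplus>k\<in>{..Suc n}. ?b k)"
    using x y by (subst add.finprod_Suc) (auto simp: binomial_eq_0)
  have b': "\<dots> = (\<Oplus>k\<in>{..n}. ?b (Suc k)) \<oplus> ?b 0"
    using x y by (subst add.finprod_Suc2) auto
  have "(\<Oplus>k\<in>{..Suc n}. ?t (Suc n) k) = (\<Oplus>k\<in>{..n}. ?t (Suc n) (Suc k)) \<oplus> ?b 0"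
    using x y by (subst add.finprod_Suc2) auto
  also have "(\<Oplus>k\<in>{..n}. ?t (Suc n) (Suc k))
    = (\<Oplus>k\<in>{..n}. [(n choose k)] \<cdot> (x [^] Suc k \<otimes> y [^] (n - k)) \<oplus> ?b (Suc k))"
    using x y by (intro finsum_cong') (auto simp: add.nat_pow_mult)
  also have "\<dots> = (\<Oplus>k\<in>{..n}. [(n choose k)] \<cdot> (x [^] Suc k \<otimes> y [^] (n - k)))
      \<oplus> (\<Oplus>k\<in>{..n}. ?b (Suc k))"
    using x y by (intro finsum_addf) auto
  also have "\<dots> \<oplus> ?b 0 = ?S \<otimes> x \<oplus> ?S \<otimes> y"
    unfolding Sx Sy b b' using x y by (subst a_assoc) (auto intro!: finsum_closed)
  also have "\<dots> = ?S \<otimes> (x \<oplus> y)"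
    using x y by (subst r_distr) (auto intro!: finsum_closed)
  finally show ?case using Suc.IH by simp
qed

text \<open>For exponent \<open>p\<close> all inner binomial coefficients are multiples of
  \<open>p\<close>, so only the two end terms survive; exponent \<open>p ^ n\<close> is this map
  iterated. The setting is a commutative ring because the identity is applied both to a field and to
  its polynomial ring.\<close>

lemma (in cring) prime_power_add:
  fixes p :: nat
  assumes p: "prime p" and char: "[p] \<cdot> \<one> = \<zero>"
    and x: "x \<in> carrier R" and y: "y \<in> carrier R"
  shows "(x \<oplus> y) [^] (p ^ n) = x [^] (p ^ n) \<oplus> y [^] (p ^ n)"
proof (induction n)
  case 0
  then show ?case using x y by (simp add: nat_pow_eone)
next
  case (Suc n)
  have zero: "[k] \<cdot> z = \<zero>" if "p dvd k" "z \<in> carrier R" for k :: nat and z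
  proof -
    obtain j where "k = p * j" using \<open>p dvd k\<close> by auto
    have "[p] \<cdot> z = [p] \<cdot> \<one> \<otimes> z"
      using that by (simp only: add_pow_ldistr one_closed l_one)
    also have "\<dots> = \<zero>" using that char by simp
    finally show ?thesis
      using add.nat_pow_pow[OF \<open>z \<in> carrier R\<close>, of j p] \<open>k = p * j\<close> by simp
  qed
  have frob: "(u \<oplus> v) [^] p = u [^] p \<oplus> v [^] p" if u: "u \<in> carrier R" and v: "v \<in> carrier R" for u v
  proof -
    \<comment> \<open>With \<open>p = m + 2\<close> the last and the first term are split off, and
      the remaining indices \<open>Suc k\<close> with \<open>k \<le> m\<close> lie strictly between
      0 and \<open>p\<close>.\<close>
    obtain m where m: "p = Suc (Suc m)"
      using prime_ge_2_nat[OF p] that[of "p - 2"] by simp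
    let ?t = "\<lambda>k. [(p choose k)] \<cdot> (u [^] k \<otimes> v [^] (p - k))"
    have "(u \<oplus> v) [^] p = (\<Oplus>k\<in>{..p}. ?t k)"
      by (rule binomial[OF u v])
    also have "\<dots> = ?t p \<oplus> (\<Oplus>k\<in>{..Suc m}. ?t k)"
      unfolding m using u v by (subst add.finprod_Suc) auto
    also have "(\<Oplus>k\<in>{..Suc m}. ?t k) = (\<Oplus>k\<in>{..m}. ?t (Suc k)) \<oplus> ?t 0"
      using u v by (subst add.finprod_Suc2) auto
    also have "(\<Oplus>k\<in>{..m}. ?t (Suc k)) = (\<Oplus>k\<in>{..m}. \<zero>)"
      using u v m p by (intro finsum_cong' zero dvd_choose_prime) auto
    also have "\<dots> = \<zero>" by (rule finsum_zero)
    finally show ?thesis using u v by simp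
  qed
  have "(x \<oplus> y) [^] (p ^ Suc n) = ((x \<oplus> y) [^] (p ^ n)) [^] p"
    using x y by (simp add: nat_pow_pow mult.commute)
  also have "\<dots> = (x [^] (p ^ n)) [^] p \<oplus> (y [^] (p ^ n)) [^] p"
    using x y by (simp add: Suc.IH frob)
  finally show ?case
    using x y by (simp add: nat_pow_pow mult.commute)
qed

text \<open>Additivity is applied to \<open>(x - y) + y\<close>. This avoids evaluating powers of
  -1, so \<open>p = 2\<close> is not a separate case.\<close>

lemma (in cring) prime_power_diff:
  fixes p :: nat
  assumes p: "prime p" and char: "[p] \<cdot> \<one> = \<zero>"
    and x: "x \<in> carrier R" and y: "y \<in> carrier R"
  shows "(x \<ominus> y) [^] (p ^ n) = x [^] (p ^ n) \<ominus> y [^] (p ^ n)"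
proof -
  have "x [^] (p ^ n) = ((x \<ominus> y) \<oplus> y) [^] (p ^ n)"
    using x y by (simp add: minus_eq a_assoc l_neg)
  also have "\<dots> = (x \<ominus> y) [^] (p ^ n) \<oplus> y [^] (p ^ n)"
    using x y by (intro prime_power_add[OF p char]) auto
  finally have eq: "x [^] (p ^ n) = (x \<ominus> y) [^] (p ^ n) \<oplus> y [^] (p ^ n)" .
  have "(u \<oplus> v) \<ominus> v = u" if "u \<in> carrier R" "v \<in> carrier R" for u v
    using that by (simp add: minus_eq a_assoc r_neg)
  then show ?thesis
    unfolding eq using x y by simp
qed

section \<open>Finite fields as root sets of X^q - X\<close>

lemma ring_hom_add_pow_one:
  assumes h: "h \<in> ring_hom R S" and "ring R" "ring S"
  shows "h ([(n::nat)] \<cdot>\<^bsub>R\<^esub> \<one>\<^bsub>R\<^esub>) = [n] \<cdot>\<^bsub>S\<^esub> \<one>\<^bsub>S\<^esub>"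
proof -
  interpret R: ring R by fact
  interpret S: ring S by fact
  show ?thesis
  proof (induction n)
    case 0
    then show ?case using ring_hom_zero[OF h] assms by simp
  next
    case (Suc n)
    then show ?case
      by (simp add: ring_hom_add[OF h] ring_hom_one[OF h])
  qed
qed

text \<open>The fixed points are the roots of X^q - X with \<open>q = p ^ n\<close>. As this
  polynomial splits, it has q roots counted with multiplicity, and what remains is that every root
  is simple.\<close>

lemma (in domain) card_roots_fixed_prime_power:
  fixes p :: nat
  assumes p: "prime p" and char: "[p] \<cdot> \<one> = \<zero>" and n: "n > 0"
    and splits: "\<And>P. P \<in> carrier (poly_ring R) \<Longrightarrow> splitted P"
  shows "finite {a \<in> carrier R. a [^] (p ^ n) = a}"
    and "card {a \<in> carrier R. a [^] (p ^ n) = a} = p ^ n"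
proof -
  define q where "q = p ^ n"
  have q: "q > 1" unfolding q_def using p n one_less_power[OF prime_gt_1_nat] by blast
  let ?K = "carrier R"
  note sub = carrier_is_subring
  interpret UP: domain "poly_ring R" by (rule univ_poly_is_domain[OF sub])
  have diff_diff: "u \<ominus>\<^bsub>poly_ring R\<^esub> w
      = (v \<ominus>\<^bsub>poly_ring R\<^esub> w) \<ominus>\<^bsub>poly_ring R\<^esub> (v \<ominus>\<^bsub>poly_ring R\<^esub> u)"
    if "u \<in> carrier (poly_ring R)" "v \<in> carrier (poly_ring R)" "w \<in> carrier (poly_ring R)" for u v w
    using that by algebra
  have distrib: "u \<otimes>\<^bsub>poly_ring R\<^esub> v \<ominus>\<^bsub>poly_ring R\<^esub> u \<otimes>\<^bsub>poly_ring R\<^esub> w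
      = u \<otimes>\<^bsub>poly_ring R\<^esub> (v \<ominus>\<^bsub>poly_ring R\<^esub> w)"
    if "u \<in> carrier (poly_ring R)" "v \<in> carrier (poly_ring R)" "w \<in> carrier (poly_ring R)" for u v w
    using that by algebra
  define P where "P = X [^]\<^bsub>poly_ring R\<^esub> q \<ominus>\<^bsub>poly_ring R\<^esub> X"
  have X: "X \<in> carrier (poly_ring R)" by (rule var_closed(1)[OF sub])
  have P: "P \<in> carrier (poly_ring R)" unfolding P_def using X by simp
  have degX: "degree X = 1" by (simp add: var_def)
  have negX: "\<ominus>\<^bsub>poly_ring R\<^esub> X \<in> carrier (poly_ring R)" using X by simp
  have degnegX: "degree (\<ominus>\<^bsub>poly_ring R\<^esub> X) = 1"
    using univ_poly_a_inv_degree[OF sub X] degX by simp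
  have degXq: "degree (X [^]\<^bsub>poly_ring R\<^esub> q) = q"
    using polynomial_pow_degree[OF X, of q] degX by simp
  have degP: "degree P = q"
    unfolding P_def a_minus_def univ_poly_add
    using poly_add_degree_eq[OF sub, of "X [^]\<^bsub>poly_ring R\<^esub> q" "\<ominus>\<^bsub>poly_ring R\<^esub> X"]
      X negX degXq degnegX q by (simp add: univ_poly_carrier)
  have P0: "P \<noteq> []" using degP q by auto
  have evalP: "eval P a = a [^] q \<ominus> a" if a: "a \<in> carrier R" for a
  proof -
    interpret ev: ring_hom_ring "poly_ring R" R "\<lambda>P. eval P a"
      by (rule eval_ring_hom[OF sub a])
    show ?thesis unfolding P_def a_minus_def
      using X a by (simp add: ev.hom_nat_pow eval_var)
  qed
  have charUP: "[p] \<cdot>\<^bsub>poly_ring R\<^esub> \<one>\<^bsub>poly_ring R\<^esub> = \<zero>\<^bsub>poly_ring R\<^esub>"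
  proof -
    have hom: "poly_of_const \<in> ring_hom R (poly_ring R)"
      using canonical_embedding_is_hom[OF sub] by simp
    show ?thesis
      using ring_hom_add_pow_one[OF hom ring_axioms UP.ring_axioms, of p]
      unfolding char ring_hom_zero[OF hom ring_axioms UP.ring_axioms] by (rule sym)
  qed
  \<comment> \<open>By the Frobenius identity \<open>P = Y^q - Y\<close> for \<open>Y = X - a\<close>, and \<open>Y^2\<close> divides \<open>Y^q\<close> but not \<open>Y\<close>.\<close>
  have simple: "alg_mult P a \<le> 1" if a: "a \<in> carrier R" and fix_a: "a [^] q = a" for a
  proof (rule ccontr)
    let ?Y = "[\<one>, \<ominus> a]"
    interpret const: ring_hom_ring R "poly_ring R" poly_of_const
      using canonical_embedding_ring_hom[OF sub] by simp
    have A: "poly_of_const a \<in> carrier (poly_ring R)" using a by simp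
    have Y: "?Y \<in> carrier (poly_ring R)"
      using a by (auto simp: sym[OF univ_poly_carrier] polynomial_def)
    have Y_eq: "?Y = X \<ominus>\<^bsub>poly_ring R\<^esub> poly_of_const a"
    proof -
      have "X \<ominus>\<^bsub>poly_ring R\<^esub> poly_of_const a = X \<oplus>\<^bsub>poly_ring R\<^esub> poly_of_const (\<ominus> a)"
        using a by (simp add: a_minus_def)
      also have "\<dots> = ?Y"
        using a by (auto simp: univ_poly_add var_def poly_of_const_def)
      finally show ?thesis ..
    qed
    have "?Y [^]\<^bsub>poly_ring R\<^esub> q
        = X [^]\<^bsub>poly_ring R\<^esub> q \<ominus>\<^bsub>poly_ring R\<^esub> poly_of_const a [^]\<^bsub>poly_ring R\<^esub> q"
      unfolding Y_eq q_def by (rule UP.prime_power_diff[OF p charUP X A])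
    also have "poly_of_const a [^]\<^bsub>poly_ring R\<^esub> q = poly_of_const a"
      using a fix_a by (simp flip: const.hom_nat_pow)
    finally have Yq: "?Y = ?Y [^]\<^bsub>poly_ring R\<^esub> q \<ominus>\<^bsub>poly_ring R\<^esub> P"
      unfolding P_def Y_eq by (simp only: diff_diff[OF X UP.nat_pow_closed[OF X] A])
    assume "\<not> alg_mult P a \<le> 1"
    then have YP: "?Y [^]\<^bsub>poly_ring R\<^esub> (2::nat) pdivides P"
      using le_alg_mult_imp_pdivides[OF a P, of 2] by simp
    have YYq: "?Y [^]\<^bsub>poly_ring R\<^esub> (2::nat) pdivides ?Y [^]\<^bsub>poly_ring R\<^esub> q"
      using q by (intro polynomial_pow_division[OF Y]) auto
    have "?Y [^]\<^bsub>poly_ring R\<^esub> (2::nat) pdivides ?Y"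
    proof -
      obtain C D where CD: "C \<in> carrier (poly_ring R)" "D \<in> carrier (poly_ring R)"
        "P = ?Y [^]\<^bsub>poly_ring R\<^esub> (2::nat) \<otimes>\<^bsub>poly_ring R\<^esub> C"
        "?Y [^]\<^bsub>poly_ring R\<^esub> q = ?Y [^]\<^bsub>poly_ring R\<^esub> (2::nat) \<otimes>\<^bsub>poly_ring R\<^esub> D"
        using YP YYq unfolding pdivides_def factor_def by auto
      have "?Y = ?Y [^]\<^bsub>poly_ring R\<^esub> (2::nat) \<otimes>\<^bsub>poly_ring R\<^esub> (D \<ominus>\<^bsub>poly_ring R\<^esub> C)"
        using Yq[unfolded CD(3,4)] unfolding distrib[OF UP.nat_pow_closed[OF Y] CD(2) CD(1)] .
      then show ?thesis using CD(1,2) unfolding pdivides_def factor_def by blast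
    qed
    then have "degree (?Y [^]\<^bsub>poly_ring R\<^esub> (2::nat)) \<le> degree ?Y"
      using pdivides_imp_degree_le[OF sub _ Y] Y by simp
    then show False using polynomial_pow_degree[OF Y, of 2] by simp
  qed
  have roots: "set_mset (roots P) = {a \<in> carrier R. a [^] q = a}"
  proof -
    have "a \<in># roots P \<longleftrightarrow> a \<in> carrier R \<and> a [^] q = a" for a
      using roots_mem_iff_is_root[OF P, of a] P0 evalP[of a]
      by (cases "a \<in> carrier R") (simp_all add: is_root_def)
    then show ?thesis by blast
  qed
  show "finite {a \<in> carrier R. a [^] (p ^ n) = a}"
    using finite_set_mset[of "roots P"] unfolding roots q_def .
  have count: "count (roots P) a = 1" if "a \<in> set_mset (roots P)" for a
  proof (rule antisym)
    show "count (roots P) a \<le> 1"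
      using that simple[of a] unfolding roots alg_mult_eq_count_roots[OF P] by blast
    show "1 \<le> count (roots P) a"
      using that by (simp add: Suc_le_eq)
  qed
  have "size (roots P) = (\<Sum>a\<in>set_mset (roots P). 1)"
    unfolding size_multiset_overloaded_eq using count by (rule sum.cong[OF refl])
  then have "card (set_mset (roots P)) = size (roots P)"
    by simp
  then show "card {a \<in> carrier R. a [^] (p ^ n) = a} = p ^ n"
    using splits[OF P] degP unfolding roots splitted_def q_def by simp
qed

text \<open>In an algebraic closure of Z/p the map x -> x^q respects the field operations, so its
  fixed points form a subfield; the previous lemma gives its size.\<close>

lemma exists_finite_field:
  assumes "primepow q"
  shows "\<exists>F :: nat ring. field F \<and> finite (carrier F) \<and> card (carrier F) = q"
proof -
  obtain p n where p: "prime p" and n: "n > 0" and q: "q = p ^ n"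
    using assms unfolding primepow_def by auto
  interpret Z: residues_prime p "residue_ring (int p)"
    by unfold_locales (use p in simp_all)
  interpret ZF: field "residue_ring (int p)" by (rule Z.is_field)
  define L where "L = field.alg_closure (residue_ring (int p))"
  interpret L: algebraic_closure L "ring.indexed_const (residue_ring (int p)) ` carrier (residue_ring (int p))"
    unfolding L_def by (rule field.alg_closureE[OF Z.is_field])
  have hom: "ring.indexed_const (residue_ring (int p)) \<in> ring_hom (residue_ring (int p)) L"
    unfolding L_def by (rule field.alg_closureE[OF Z.is_field])
  \<comment> \<open>Lagrange's theorem in the additive group of order \<open>p\<close>.\<close>
  have "[p] \<cdot>\<^bsub>residue_ring (int p)\<^esub> \<one>\<^bsub>residue_ring (int p)\<^esub> = \<zero>\<^bsub>residue_ring (int p)\<^esub>"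
    using group.pow_order_eq_1[OF Z.a_group, of "\<one>\<^bsub>residue_ring (int p)\<^esub>"] prime_gt_1_nat[OF p]
    by (simp add: order_def add_pow_def Z.res_carrier_eq Z.res_one_eq)
  then have char: "[p] \<cdot>\<^bsub>L\<^esub> \<one>\<^bsub>L\<^esub> = \<zero>\<^bsub>L\<^esub>"
    using ring_hom_add_pow_one[OF hom Z.ring_axioms L.ring_axioms, of p]
      ring_hom_zero[OF hom Z.ring_axioms L.ring_axioms] by simp
  define K where "K = {a \<in> carrier L. a [^]\<^bsub>L\<^esub> q = a}"
  have K: "finite K" "card K = q"
    unfolding K_def q using L.card_roots_fixed_prime_power[OF p char n L.roots_over_carrier] by auto
  have q0: "q > 0" unfolding q using p by (simp add: prime_gt_0_nat)
  have "subring K L"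
  proof (rule L.subringI)
    show "\<ominus>\<^bsub>L\<^esub> a \<in> K" if "a \<in> K" for a
    proof -
      \<comment> \<open>Written as a difference, a negative is covered by
        \<open>prime_power_diff\<close> for odd and even \<open>p\<close> alike.\<close>
      have "\<ominus>\<^bsub>L\<^esub> a = \<zero>\<^bsub>L\<^esub> \<ominus>\<^bsub>L\<^esub> a" using that by (simp add: K_def L.minus_eq)
      then show ?thesis
        using that L.prime_power_diff[OF p char, of "\<zero>\<^bsub>L\<^esub>" a n] q0
        by (simp add: K_def q L.nat_pow_zero)
    qed
  qed (use L.prime_power_add[OF p char] in \<open>auto simp: K_def q L.nat_pow_distrib\<close>)
  moreover have "inv\<^bsub>L\<^esub> a \<in> K" if "a \<in> K - {\<zero>\<^bsub>L\<^esub>}" for a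
  proof -
    have a: "a \<in> carrier L" "a [^]\<^bsub>L\<^esub> q = a" "a \<in> Units L"
      using that by (auto simp: K_def L.field_Units)
    then have "inv\<^bsub>L\<^esub> a [^]\<^bsub>L\<^esub> q \<otimes>\<^bsub>L\<^esub> a = \<one>\<^bsub>L\<^esub>"
      using L.nat_pow_distrib[of "inv\<^bsub>L\<^esub> a" a q] by simp
    then have "inv\<^bsub>L\<^esub> a = inv\<^bsub>L\<^esub> a [^]\<^bsub>L\<^esub> q"
      using a by (intro L.comm_inv_char) (simp_all add: L.m_comm)
    then show ?thesis using a by (simp add: K_def)
  qed
  ultimately have "subfield K L" by (rule L.subfieldI')
  then interpret K: field "L\<lparr>carrier := K\<rparr>" by (rule L.subfield_iff(2))
  \<comment> \<open>The subfield lives in the type of the algebraic closure; an injection transports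
    its structure to natural numbers, as \<open>has_subgroup_iso_PGL2\<close> demands.\<close>
  obtain f :: "_ \<Rightarrow> nat" where f: "inj_on f K"
    using finite_imp_inj_to_nat_seg[OF K(1)] by blast
  have "field (image_ring f (L\<lparr>carrier := K\<rparr>))"
    using K.inj_imp_image_ring_is_field[of f] f by simp
  moreover have "carrier (image_ring f (L\<lparr>carrier := K\<rparr>)) = f ` K"
    by (simp add: image_ring_carrier)
  ultimately show ?thesis
    using K f by (intro exI[of _ "image_ring f (L\<lparr>carrier := K\<rparr>)"]) (auto simp: card_image)
qed

section \<open>Coherent quadruples in tournaments\<close>

text \<open>Reading \<open>t x y\<close> as the sign of \<open>[x y]\<close>, the three products
  \<open>[w x][y z]\<close>, \<open>[w y][z x]\<close>, \<open>[w z][x y]\<close> have equal signs.\<close>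

definition coherent :: "('v \<Rightarrow> 'v \<Rightarrow> bool) \<Rightarrow> 'v \<Rightarrow> 'v \<Rightarrow> 'v \<Rightarrow> 'v \<Rightarrow> bool" where
  "coherent t w x y z \<longleftrightarrow>
     (t w x = t y z) = (t w y = t z x) \<and> (t w x = t y z) = (t w z = t x y)"

definition coherent_quads :: "'v set \<Rightarrow> ('v \<Rightarrow> 'v \<Rightarrow> bool) \<Rightarrow> 'v set set" where
  "coherent_quads V t =
     {{w, x, y, z} | w x y z. {w, x, y, z} \<subseteq> V \<and> distinct [w, x, y, z] \<and> coherent t w x y z}"

locale tournament =
  fixes V :: "'v set" and t :: "'v \<Rightarrow> 'v \<Rightarrow> bool"
  assumes finite_V: "finite V"
    and asym: "\<lbrakk>x \<in> V; y \<in> V; x \<noteq> y\<rbrakk> \<Longrightarrow> t y x \<longleftrightarrow> \<not> t x y"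
begin

text \<open>Coherence does not depend on the order of the four points: exchanging two of them
  permutes the three products and negates all of them. The proof goes through all possible
  orderings.\<close>

lemma coherent_quads_iff:
  assumes V: "w \<in> V" "x \<in> V" "y \<in> V" "z \<in> V" and dist: "distinct [w, x, y, z]"
  shows "{w, x, y, z} \<in> coherent_quads V t \<longleftrightarrow> coherent t w x y z"
proof
  assume "{w, x, y, z} \<in> coherent_quads V t"
  then obtain w' x' y' z' where eq: "{w, x, y, z} = {w', x', y', z'}"
    and dist': "distinct [w', x', y', z']" and coh: "coherent t w' x' y' z'"
    unfolding coherent_quads_def by blast
  have anti: "t x w \<longleftrightarrow> \<not> t w x" "t y w \<longleftrightarrow> \<not> t w y" "t z w \<longleftrightarrow> \<not> t w z"
    "t y x \<longleftrightarrow> \<not> t x y" "t z x \<longleftrightarrow> \<not> t x z" "t z y \<longleftrightarrow> \<not> t y z"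
    using V dist by (intro asym; simp)+
  have "w' \<in> {w, x, y, z}" "x' \<in> {w, x, y, z}" "y' \<in> {w, x, y, z}" "z' \<in> {w, x, y, z}"
    using eq by blast+
  then have "w' = w \<or> w' = x \<or> w' = y \<or> w' = z" "x' = w \<or> x' = x \<or> x' = y \<or> x' = z"
    "y' = w \<or> y' = x \<or> y' = y \<or> y' = z" "z' = w \<or> z' = x \<or> z' = y \<or> z' = z"
    by simp_all
  then show "coherent t w x y z"
    using dist' coh unfolding coherent_def
    by (elim disjE) (simp_all add: anti, blast+)
next
  assume "coherent t w x y z"
  then show "{w, x, y, z} \<in> coherent_quads V t"
    using assms unfolding coherent_quads_def by blast
qed

lemma coherent_quadsD:
  assumes "A \<in> coherent_quads V t"
  shows "A \<subseteq> V" "card A = 4"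
  using assms unfolding coherent_quads_def by auto

lemma uniform_coherent_quads: "uniform_hypergraph 4 V (coherent_quads V t)"
  unfolding uniform_hypergraph_def using finite_V coherent_quadsD by blast

end

text \<open>A \<open>k\<close>-subset of a set of size \<open>k + 1\<close> is determined by the one
  vertex that it omits.\<close>

lemma spanned_hyperedges_card_Suc:
  assumes E: "\<And>A. A \<in> E \<Longrightarrow> card A = k" and S: "finite S" "card S = Suc k"
  shows "card (spanned_hyperedges E S) = card {i \<in> S. S - {i} \<in> E}"
proof (rule bij_betw_same_card[symmetric])
  have "A \<in> (\<lambda>i. S - {i}) ` {i \<in> S. S - {i} \<in> E}" if A: "A \<in> E" "A \<subseteq> S" for A
  proof -
    have "card (S - A) = 1"
      using E[OF A(1)] S A(2) by (simp add: card_Diff_subset finite_subset)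
    then obtain i where i: "S - A = {i}" by (auto simp: card_1_singleton_iff)
    then have "A = S - {i}" "i \<in> S" using A(2) by auto
    then show ?thesis using A(1) by auto
  qed
  then show "bij_betw (\<lambda>i. S - {i}) {i \<in> S. S - {i} \<in> E} (spanned_hyperedges E S)"
    unfolding bij_betw_def inj_on_def spanned_hyperedges_def by blast
qed

text \<open>A tournament on five points is given by ten Booleans, one for each pair. The count is a
  sum of five coherence conditions in these Booleans, and all orientations are checked.\<close>

lemma (in tournament) card_spanned_coherent_quads:
  assumes S: "S \<subseteq> V" "card S = 5"
  shows "card (spanned_hyperedges (coherent_quads V t) S) \<in> {0, 2}"
proof -
  have fin: "finite S" using S finite_V finite_subset by blast
  obtain a b c d e where S_eq: "S = {a, b, c, d, e}" and dist: "distinct [a, b, c, d, e]"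
  proof -
    obtain xs where xs: "set xs = S" "distinct xs"
      using finite_distinct_list[OF fin] by blast
    then have "length xs = 5" using S(2) distinct_card by force
    then obtain a b c d e where "xs = [a, b, c, d, e]"
      by (auto simp: numeral_eq_Suc length_Suc_conv)
    then show thesis using xs that by auto
  qed
  let ?E = "coherent_quads V t"
  have V: "a \<in> V" "b \<in> V" "c \<in> V" "d \<in> V" "e \<in> V" using S S_eq by auto
  have drop: "S - {a} = {b, c, d, e}" "S - {b} = {a, c, d, e}" "S - {c} = {a, b, d, e}"
    "S - {d} = {a, b, c, e}" "S - {e} = {a, b, c, d}"
    using dist unfolding S_eq by auto
  \<comment> \<open>Rewriting backward arcs leaves only arcs in alphabetical direction, hence one
    Boolean for each pair.\<close>
  have anti: "t d b \<longleftrightarrow> \<not> t b d" "t d a \<longleftrightarrow> \<not> t a d" "t e c \<longleftrightarrow> \<not> t c e"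
    "t e b \<longleftrightarrow> \<not> t b e" "t e d \<longleftrightarrow> \<not> t d e" "t c a \<longleftrightarrow> \<not> t a c" "t c b \<longleftrightarrow> \<not> t b c"
    using V dist by (intro asym; simp)+
  have "card (spanned_hyperedges ?E S) = card {i \<in> S. S - {i} \<in> ?E}"
    using S fin coherent_quadsD by (intro spanned_hyperedges_card_Suc[where k = 4]) auto
  also have "\<dots> = (\<Sum>i\<in>S. of_bool (S - {i} \<in> ?E))"
    using fin by (simp add: Int_def)
  also have "\<dots> = of_bool (S - {a} \<in> ?E) + of_bool (S - {b} \<in> ?E) + of_bool (S - {c} \<in> ?E)
      + of_bool (S - {d} \<in> ?E) + of_bool (S - {e} \<in> ?E)"
    using dist by (subst (1) S_eq) (simp add: add.assoc)
  also have "\<dots> = of_bool (coherent t b c d e) + of_bool (coherent t a c d e)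
      + of_bool (coherent t a b d e) + of_bool (coherent t a b c e) + of_bool (coherent t a b c d)"
    using V dist unfolding drop by (simp add: coherent_quads_iff)
  also have "\<dots> \<in> {0, 2}"
    unfolding coherent_def anti
    by (cases "t a b"; cases "t a c"; cases "t a d"; cases "t a e"; cases "t b c"; cases "t b d";
        cases "t b e"; cases "t c d"; cases "t c e"; cases "t d e"; simp)
  finally show ?thesis .
qed

text \<open>Double counting of the pairs of an \<open>m\<close>-set \<open>T\<close> and a hyperedge
  \<open>A\<close> that contains it.\<close>

lemma sum_card_supersets:
  assumes V: "finite V" and E: "\<And>A. A \<in> E \<Longrightarrow> A \<subseteq> V \<and> card A = k"
    and l: "\<And>T. \<lbrakk>T \<subseteq> V; card T = m\<rbrakk> \<Longrightarrow> card {A \<in> E. T \<subseteq> A} = l"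
  shows "card E * (k choose m) = l * (card V choose m)"
proof -
  let ?T = "{T. T \<subseteq> V \<and> card T = m}"
  have finT: "finite ?T" using V by simp
  have finE: "finite E" by (rule finite_subset[of _ "Pow V"]) (use E V in auto)
  have "card E * (k choose m) = (\<Sum>A\<in>E. card {T \<in> ?T. T \<subseteq> A})"
  proof -
    have "card {T \<in> ?T. T \<subseteq> A} = k choose m" if "A \<in> E" for A
    proof -
      have "{T \<in> ?T. T \<subseteq> A} = {T. T \<subseteq> A \<and> card T = m}" using E[OF that] by auto
      then show ?thesis using n_subsets[of A m] E[OF that] V finite_subset by metis
    qed
    then show ?thesis by simp
  qed
  also have "\<dots> = (\<Sum>T\<in>?T. card {A \<in> E. T \<subseteq> A})"
    using sum.swap_restrict[OF finE finT, of "\<lambda>_ _. 1 :: nat" "\<lambda>A T. T \<subseteq> A"]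
    by (simp add: conj_commute)
  also have "\<dots> = l * (card V choose m)"
    using l n_subsets[OF V, of m] by simp
  finally show ?thesis .
qed

section \<open>The action of the general linear group on the projective line\<close>

definition det2 :: "('a, 'm) ring_scheme \<Rightarrow> 'a \<times> 'a \<Rightarrow> 'a \<times> 'a \<Rightarrow> 'a" where
  "det2 F = (\<lambda>(a, b) (c, d). a \<otimes>\<^bsub>F\<^esub> d \<ominus>\<^bsub>F\<^esub> b \<otimes>\<^bsub>F\<^esub> c)"

definition mat2_app :: "('a, 'm) ring_scheme \<Rightarrow> 'a mat2 \<Rightarrow> 'a \<times> 'a \<Rightarrow> 'a \<times> 'a" where
  "mat2_app F = (\<lambda>(a, b, c, d) (x, y).
     (a \<otimes>\<^bsub>F\<^esub> x \<oplus>\<^bsub>F\<^esub> b \<otimes>\<^bsub>F\<^esub> y, c \<otimes>\<^bsub>F\<^esub> x \<oplus>\<^bsub>F\<^esub> d \<otimes>\<^bsub>F\<^esub> y))"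

definition smult2 :: "('a, 'm) ring_scheme \<Rightarrow> 'a \<Rightarrow> 'a \<times> 'a \<Rightarrow> 'a \<times> 'a" where
  "smult2 F c = (\<lambda>(x, y). (c \<otimes>\<^bsub>F\<^esub> x, c \<otimes>\<^bsub>F\<^esub> y))"

context field
begin

section \<open>Two-by-two matrices over a field\<close>

abbreviation "plane \<equiv> carrier R \<times> carrier R"
abbreviation "mats \<equiv> carrier R \<times> carrier R \<times> carrier R \<times> carrier R"

lemma det2_closed [simp, intro]: "\<lbrakk>v \<in> plane; w \<in> plane\<rbrakk> \<Longrightarrow> det2 R v w \<in> carrier R"
  by (auto simp: det2_def)

lemma mat2_det_closed [simp, intro]: "M \<in> mats \<Longrightarrow> mat2_det R M \<in> carrier R"
  by (auto simp: mat2_det_def)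

lemma mat2_app_closed [simp, intro]: "\<lbrakk>M \<in> mats; v \<in> plane\<rbrakk> \<Longrightarrow> mat2_app R M v \<in> plane"
  by (auto simp: mat2_app_def)

lemma mat2_mult_closed [simp, intro]: "\<lbrakk>M \<in> mats; N \<in> mats\<rbrakk> \<Longrightarrow> mat2_mult R M N \<in> mats"
  by (auto simp: mat2_mult_def)

lemma smult2_closed [simp, intro]: "\<lbrakk>c \<in> carrier R; v \<in> plane\<rbrakk> \<Longrightarrow> smult2 R c v \<in> plane"
  by (auto simp: smult2_def)

lemma det2_swap: "\<lbrakk>v \<in> plane; w \<in> plane\<rbrakk> \<Longrightarrow> det2 R w v = \<ominus> det2 R v w"
  by (clarsimp simp: det2_def) algebra

lemma det2_smult2:
  "\<lbrakk>c \<in> carrier R; d \<in> carrier R; v \<in> plane; w \<in> plane\<rbrakk> \<Longrightarrow>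
    det2 R (smult2 R c v) (smult2 R d w) = c \<otimes> d \<otimes> det2 R v w"
  by (clarsimp simp: det2_def smult2_def) algebra

lemma det2_mat2_app:
  "\<lbrakk>M \<in> mats; v \<in> plane; w \<in> plane\<rbrakk> \<Longrightarrow>
    det2 R (mat2_app R M v) (mat2_app R M w) = mat2_det R M \<otimes> det2 R v w"
  by (clarsimp simp: det2_def mat2_det_def mat2_app_def) algebra

lemma mat2_app_smult2:
  "\<lbrakk>M \<in> mats; c \<in> carrier R; v \<in> plane\<rbrakk> \<Longrightarrow>
    mat2_app R M (smult2 R c v) = smult2 R c (mat2_app R M v)"
  by (clarsimp simp: smult2_def mat2_app_def) (intro conjI; algebra)

lemma smult2_smult2:
  "\<lbrakk>c \<in> carrier R; d \<in> carrier R; v \<in> plane\<rbrakk> \<Longrightarrow> smult2 R c (smult2 R d v) = smult2 R (c \<otimes> d) v"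
  by (clarsimp simp: smult2_def m_assoc)

lemma mat2_app_mult:
  "\<lbrakk>M \<in> mats; N \<in> mats; v \<in> plane\<rbrakk> \<Longrightarrow>
    mat2_app R (mat2_mult R M N) v = mat2_app R M (mat2_app R N v)"
  by (clarsimp simp: mat2_mult_def mat2_app_def) (intro conjI; algebra)

lemma mat2_det_mult:
  "\<lbrakk>M \<in> mats; N \<in> mats\<rbrakk> \<Longrightarrow> mat2_det R (mat2_mult R M N) = mat2_det R M \<otimes> mat2_det R N"
  by (clarsimp simp: mat2_mult_def mat2_det_def) algebra

lemma mat2_mult_assoc:
  "\<lbrakk>L \<in> mats; M \<in> mats; N \<in> mats\<rbrakk> \<Longrightarrow>
    mat2_mult R (mat2_mult R L M) N = mat2_mult R L (mat2_mult R M N)"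
  by (clarsimp simp: mat2_mult_def) (intro conjI; algebra)

lemma carrier_GL2: "M \<in> carrier (GL2 R) \<longleftrightarrow> M \<in> mats \<and> mat2_det R M \<noteq> \<zero>"
  by (auto simp: GL2_def)

lemma mult_GL2: "M \<otimes>\<^bsub>GL2 R\<^esub> N = mat2_mult R M N"
  by (simp add: GL2_def)

lemma group_GL2: "group (GL2 R)"
proof (rule groupI)
  show "\<one>\<^bsub>GL2 R\<^esub> \<in> carrier (GL2 R)"
    by (simp add: GL2_def mat2_det_def minus_eq)
next
  fix M N assume "M \<in> carrier (GL2 R)" "N \<in> carrier (GL2 R)"
  then show "M \<otimes>\<^bsub>GL2 R\<^esub> N \<in> carrier (GL2 R)"
    unfolding carrier_GL2 mult_GL2 by (simp add: mat2_det_mult integral_iff)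
next
  fix L M N assume "L \<in> carrier (GL2 R)" "M \<in> carrier (GL2 R)" "N \<in> carrier (GL2 R)"
  then show "L \<otimes>\<^bsub>GL2 R\<^esub> M \<otimes>\<^bsub>GL2 R\<^esub> N = L \<otimes>\<^bsub>GL2 R\<^esub> (M \<otimes>\<^bsub>GL2 R\<^esub> N)"
    unfolding carrier_GL2 mult_GL2 by (simp add: mat2_mult_assoc)
next
  fix M assume "M \<in> carrier (GL2 R)"
  then show "\<one>\<^bsub>GL2 R\<^esub> \<otimes>\<^bsub>GL2 R\<^esub> M = M"
    by (auto simp: GL2_def mat2_mult_def)
next
  fix M assume "M \<in> carrier (GL2 R)"
  then obtain a b c d where M: "M = (a, b, c, d)"
    and [simp]: "a \<in> carrier R" "b \<in> carrier R" "c \<in> carrier R" "d \<in> carrier R"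
    and det: "a \<otimes> d \<ominus> b \<otimes> c \<noteq> \<zero>"
    by (auto simp: GL2_def mat2_det_def)
  define e where "e = inv (a \<otimes> d \<ominus> b \<otimes> c)"
  have e: "e \<in> carrier R" "(a \<otimes> d \<ominus> b \<otimes> c) \<otimes> e = \<one>"
    unfolding e_def using det by (auto simp: field_Units)
  \<comment> \<open>The adjugate of \<open>M\<close> divided by the determinant.\<close>
  define N where "N = (e \<otimes> d, \<ominus> (e \<otimes> b), \<ominus> (e \<otimes> c), e \<otimes> a)"
  have NM: "mat2_mult R N M = (\<one>, \<zero>, \<zero>, \<one>)"
  proof -
    have "e \<otimes> d \<otimes> a \<oplus> \<ominus> (e \<otimes> b) \<otimes> c = (a \<otimes> d \<ominus> b \<otimes> c) \<otimes> e"
      "\<ominus> (e \<otimes> c) \<otimes> b \<oplus> e \<otimes> a \<otimes> d = (a \<otimes> d \<ominus> b \<otimes> c) \<otimes> e"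
      "e \<otimes> d \<otimes> b \<oplus> \<ominus> (e \<otimes> b) \<otimes> d = \<zero>"
      "\<ominus> (e \<otimes> c) \<otimes> a \<oplus> e \<otimes> a \<otimes> c = \<zero>"
      using e(1) \<open>a \<in> carrier R\<close> \<open>b \<in> carrier R\<close> \<open>c \<in> carrier R\<close> \<open>d \<in> carrier R\<close> by algebra+
    then show ?thesis using e(2) by (simp add: N_def M mat2_mult_def)
  qed
  have N: "N \<in> mats" using e by (simp add: N_def)
  have "mat2_det R N \<otimes> mat2_det R M = \<one>"
  proof -
    have "M \<in> mats" by (simp add: M)
    from mat2_det_mult[OF N this] show ?thesis unfolding NM by (simp add: mat2_det_def minus_eq)
  qed
  then have "mat2_det R N \<noteq> \<zero>" using M by auto
  then show "\<exists>N\<in>carrier (GL2 R). N \<otimes>\<^bsub>GL2 R\<^esub> M = \<one>\<^bsub>GL2 R\<^esub>"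
    using N NM by (intro bexI[of _ N]) (simp_all add: carrier_GL2 mult_GL2, simp add: GL2_def)
qed

end

section \<open>The projective line and its Moebius maps\<close>

locale projective_line = field +
  fixes \<omega> :: 'a
  assumes omega_notin: "\<omega> \<notin> carrier R"
begin

text \<open>The point at infinity is an element of the same type outside the carrier. Over a ring of
  natural numbers the vertices are thus again natural numbers.\<close>

definition points :: "'a set" where
  "points = insert \<omega> (carrier R)"

definition vec :: "'a \<Rightarrow> 'a \<times> 'a" where
  "vec x = (if x = \<omega> then (\<one>, \<zero>) else (x, \<one>))"

text \<open>The zero vector is sent to \<open>\<omega>\<close> as well. This value is harmless: an
  invertible matrix never maps a representative \<open>vec x\<close> to zero.\<close>

definition proj :: "'a \<times> 'a \<Rightarrow> 'a" where
  "proj = (\<lambda>(x, y). if y = \<zero> then \<omega> else x \<otimes> inv y)"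

text \<open>The restriction to \<open>points\<close> makes the map extensional, as membership in
  \<open>Bij\<close> requires.\<close>

definition moebius :: "'a mat2 \<Rightarrow> 'a \<Rightarrow> 'a" where
  "moebius M = (\<lambda>x\<in>points. proj (mat2_app R M (vec x)))"

lemma points_simps [simp]: "\<omega> \<in> points" "x \<in> carrier R \<Longrightarrow> x \<in> points"
  by (simp_all add: points_def)

lemma carrier_neq_omega: "x \<in> carrier R \<Longrightarrow> x \<noteq> \<omega>"
  using omega_notin by blast

lemma vec_simps [simp]: "vec \<omega> = (\<one>, \<zero>)" "x \<in> carrier R \<Longrightarrow> vec x = (x, \<one>)"
  using carrier_neq_omega by (auto simp: vec_def)

lemma vec_closed [simp, intro]: "x \<in> points \<Longrightarrow> vec x \<in> plane"
  by (auto simp: points_def)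

lemma det2_vec_eq_0_iff:
  assumes "x \<in> points" "y \<in> points"
  shows "det2 R (vec x) (vec y) = \<zero> \<longleftrightarrow> x = y"
proof -
  have "\<ominus> \<one> \<noteq> \<zero>" using one_not_zero by (metis minus_minus minus_zero one_closed)
  then show ?thesis
    using assms carrier_neq_omega
    by (cases "x = \<omega>"; cases "y = \<omega>")
      (auto simp: points_def det2_def minus_eq[of \<zero>] minus_eq[of \<one>] r_right_minus_eq)
qed

lemma proj_smult2_vec:
  assumes c: "c \<in> carrier R" "c \<noteq> \<zero>" and x: "x \<in> points"
  shows "proj (smult2 R c (vec x)) = x"
proof (cases "x = \<omega>")
  case True
  then show ?thesis using c by (simp add: proj_def smult2_def)
next
  case False
  then have "x \<in> carrier R" using x by (auto simp: points_def)
  moreover have "c \<otimes> x \<otimes> inv c = x"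
    using c \<open>x \<in> carrier R\<close> m_lcomm[of c x "inv c"] by (simp add: field_Units m_assoc)
  ultimately show ?thesis using c by (simp add: proj_def smult2_def)
qed

lemma vec_proj:
  assumes w: "w \<in> plane" "w \<noteq> (\<zero>, \<zero>)"
  obtains c where "c \<in> carrier R" "c \<noteq> \<zero>" "proj w \<in> points" "w = smult2 R c (vec (proj w))"
proof -
  obtain u v where uv: "w = (u, v)" "u \<in> carrier R" "v \<in> carrier R" using w by auto
  show thesis
  proof (cases "v = \<zero>")
    case True
    then show ?thesis using uv w by (intro that[of u]) (simp_all add: proj_def smult2_def)
  next
    case False
    then have v: "v \<in> Units R" using uv by (simp add: field_Units)
    then have "v \<otimes> (u \<otimes> inv v) = u"
      using uv by (simp add: m_lcomm)
    then show ?thesis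
      using uv v False by (intro that[of v]) (simp_all add: proj_def smult2_def)
  qed
qed

text \<open>The factor \<open>c\<close> measures how far the image vector is from the normalised
  representative of its point; later computations only keep track of such factors.\<close>

lemma moebiusE:
  assumes M: "M \<in> carrier (GL2 R)" and x: "x \<in> points"
  obtains c where "c \<in> carrier R" "c \<noteq> \<zero>" "moebius M x \<in> points"
    "mat2_app R M (vec x) = smult2 R c (vec (moebius M x))"
proof -
  have M': "M \<in> mats" "mat2_det R M \<noteq> \<zero>" using M by (simp_all add: carrier_GL2)
  \<comment> \<open>A second point serves as a test: the determinant of the two image vectors is
    nonzero, so neither of them is the zero vector.\<close>
  obtain y where y: "y \<in> points" "y \<noteq> x"
    using carrier_neq_omega[of \<zero>] by (metis points_simps zero_closed)
  have "det2 R (mat2_app R M (vec x)) (mat2_app R M (vec y)) \<noteq> \<zero>"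
    using M' x y det2_vec_eq_0_iff[OF x y(1)]
    by (simp add: det2_mat2_app integral_iff)
  moreover have "det2 R (\<zero>, \<zero>) (mat2_app R M (vec y)) = \<zero>"
    using mat2_app_closed[OF M'(1) vec_closed[OF y(1)]] by (auto simp: det2_def minus_eq)
  ultimately have "mat2_app R M (vec x) \<noteq> (\<zero>, \<zero>)" by auto
  then show thesis
    using vec_proj[OF mat2_app_closed[OF M'(1) vec_closed[OF x]]] that x
    unfolding moebius_def restrict_apply'[OF x] by metis
qed

lemma moebius_eqI:
  assumes "M \<in> carrier (GL2 R)" "x \<in> points" "y \<in> points" "c \<in> carrier R" "c \<noteq> \<zero>"
    and "mat2_app R M (vec x) = smult2 R c (vec y)"
  shows "moebius M x = y"
  using assms by (simp add: moebius_def proj_smult2_vec)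

lemma moebius_closed: "\<lbrakk>M \<in> carrier (GL2 R); x \<in> points\<rbrakk> \<Longrightarrow> moebius M x \<in> points"
  by (rule moebiusE)

text \<open>The correction to a bracket splits into one factor for each point, and \<open>s\<close>
  is the same function for all pairs. This is what allows the factors to cancel in
  \<open>coherent\<close>.\<close>

lemma det2_vec_moebius:
  assumes M: "M \<in> carrier (GL2 R)"
  obtains s where "\<And>x. x \<in> points \<Longrightarrow> s x \<in> carrier R \<and> s x \<noteq> \<zero>"
    and "\<And>x y. \<lbrakk>x \<in> points; y \<in> points\<rbrakk> \<Longrightarrow>
      mat2_det R M \<otimes> det2 R (vec x) (vec y)
        = s x \<otimes> s y \<otimes> det2 R (vec (moebius M x)) (vec (moebius M y))"
proof -
  have "\<forall>x. \<exists>c. x \<in> points \<longrightarrow> c \<in> carrier R \<and> c \<noteq> \<zero> \<and>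
      mat2_app R M (vec x) = smult2 R c (vec (moebius M x))"
    using moebiusE[OF M] by metis
  then obtain s where s: "\<And>x. x \<in> points \<Longrightarrow> s x \<in> carrier R \<and> s x \<noteq> \<zero> \<and>
      mat2_app R M (vec x) = smult2 R (s x) (vec (moebius M x))"
    by metis
  show thesis
  proof (rule that)
    fix x y assume xy: "x \<in> points" "y \<in> points"
    have "mat2_det R M \<otimes> det2 R (vec x) (vec y)
        = det2 R (mat2_app R M (vec x)) (mat2_app R M (vec y))"
      using M xy by (simp add: det2_mat2_app carrier_GL2)
    also have "\<dots> = s x \<otimes> s y \<otimes> det2 R (vec (moebius M x)) (vec (moebius M y))"
      using s[OF xy(1)] s[OF xy(2)] xy M moebius_closed by (simp add: det2_smult2)
    finally show "mat2_det R M \<otimes> det2 R (vec x) (vec y)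
        = s x \<otimes> s y \<otimes> det2 R (vec (moebius M x)) (vec (moebius M y))" .
  qed (use s in blast)
qed

lemma moebius_mult:
  assumes M: "M \<in> carrier (GL2 R)" and N: "N \<in> carrier (GL2 R)"
  shows "moebius (mat2_mult R M N) = compose points (moebius M) (moebius N)"
proof
  fix x
  show "moebius (mat2_mult R M N) x = compose points (moebius M) (moebius N) x"
  proof (cases "x \<in> points")
    case True
    obtain c where c: "c \<in> carrier R" "c \<noteq> \<zero>" "moebius N x \<in> points"
        "mat2_app R N (vec x) = smult2 R c (vec (moebius N x))"
      using moebiusE[OF N True] by blast
    obtain d where d: "d \<in> carrier R" "d \<noteq> \<zero>" "moebius M (moebius N x) \<in> points"
        "mat2_app R M (vec (moebius N x)) = smult2 R d (vec (moebius M (moebius N x)))"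
      using moebiusE[OF M c(3)] by blast
    have "mat2_app R (mat2_mult R M N) (vec x) = smult2 R (c \<otimes> d) (vec (moebius M (moebius N x)))"
      using M N True c d by (simp add: carrier_GL2 mat2_app_mult mat2_app_smult2 smult2_smult2)
    moreover have "mat2_mult R M N \<in> carrier (GL2 R)"
      using group.is_monoid[OF group_GL2] M N by (simp add: monoid.m_closed flip: mult_GL2)
    ultimately have "moebius (mat2_mult R M N) x = moebius M (moebius N x)"
      using True c d by (intro moebius_eqI[of _ _ _ "c \<otimes> d"]) (auto simp: integral_iff)
    then show ?thesis using True by (simp add: compose_def)
  qed (simp add: moebius_def compose_def)
qed

text \<open>Fixing \<omega>, 0 and 1 forces \<open>c = 0\<close>, \<open>b = 0\<close> and
  \<open>a = d\<close> in turn. This identifies the kernel of the action with the group divided out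
  in \<open>PGL2\<close>.\<close>

lemma moebius_eq_id_iff:
  assumes M: "M \<in> carrier (GL2 R)"
  shows "moebius M = (\<lambda>x\<in>points. x) \<longleftrightarrow> M \<in> scalar_mats2 R"
proof
  assume id: "moebius M = (\<lambda>x\<in>points. x)"
  obtain a b c d where abcd: "M = (a, b, c, d)" "a \<in> carrier R" "b \<in> carrier R" "c \<in> carrier R" "d \<in> carrier R"
    and det: "mat2_det R M \<noteq> \<zero>"
    using M by (auto simp: carrier_GL2)
  have fix_vec: "\<exists>k\<in>carrier R. mat2_app R M (vec x) = smult2 R k (vec x)" if "x \<in> points" for x
    using moebiusE[OF M that] that unfolding id by (metis restrict_apply')
  have "c = \<zero>" using fix_vec[of \<omega>] abcd by (auto simp: mat2_app_def smult2_def)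
  moreover have "b = \<zero>" using fix_vec[of \<zero>] abcd by (auto simp: mat2_app_def smult2_def)
  ultimately have "a = d" using fix_vec[of \<one>] abcd by (auto simp: mat2_app_def smult2_def)
  with \<open>b = \<zero>\<close> \<open>c = \<zero>\<close> have "M = (a, \<zero>, \<zero>, a)" "a \<noteq> \<zero>"
    using abcd det by (auto simp: mat2_det_def minus_eq)
  then show "M \<in> scalar_mats2 R" using abcd by (auto simp: scalar_mats2_def)
next
  assume "M \<in> scalar_mats2 R"
  then obtain a where a: "M = (a, \<zero>, \<zero>, a)" "a \<in> carrier R" "a \<noteq> \<zero>"
    by (auto simp: scalar_mats2_def)
  have "moebius M x = x" if "x \<in> points" for x
    using that a by (intro moebius_eqI[OF M that that, of a])
      (auto simp: points_def mat2_app_def smult2_def)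
  then show "moebius M = (\<lambda>x\<in>points. x)" by (auto simp: moebius_def)
qed

lemma inj_on_moebius:
  assumes M: "M \<in> carrier (GL2 R)"
  shows "inj_on (moebius M) points"
proof (rule inj_onI)
  fix x y assume xy: "x \<in> points" "y \<in> points" "moebius M x = moebius M y"
  obtain s where s: "\<And>x. x \<in> points \<Longrightarrow> s x \<in> carrier R \<and> s x \<noteq> \<zero>"
    "\<And>x y. \<lbrakk>x \<in> points; y \<in> points\<rbrakk> \<Longrightarrow> mat2_det R M \<otimes> det2 R (vec x) (vec y)
        = s x \<otimes> s y \<otimes> det2 R (vec (moebius M x)) (vec (moebius M y))"
    using det2_vec_moebius[OF M] by blast
  have "det2 R (vec (moebius M x)) (vec (moebius M y)) = \<zero>"
    using moebius_closed[OF M xy(1)] xy(3) by (metis det2_vec_eq_0_iff)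
  then have "mat2_det R M \<otimes> det2 R (vec x) (vec y) = \<zero>"
    using s(2)[OF xy(1,2)] s(1)[OF xy(1)] s(1)[OF xy(2)] by simp
  then show "x = y"
    using M xy det2_vec_eq_0_iff[OF xy(1,2)] by (simp add: carrier_GL2 integral_iff)
qed

text \<open>The columns of the matrix are multiples of \<open>vec x1\<close> and
  \<open>vec x2\<close>, scaled so that their sum is a multiple of \<open>vec x3\<close>.\<close>

lemma ex_moebius_triple:
  assumes x: "x1 \<in> points" "x2 \<in> points" "x3 \<in> points" and dist: "distinct [x1, x2, x3]"
  obtains M where "M \<in> carrier (GL2 R)" "moebius M \<omega> = x1" "moebius M \<zero> = x2" "moebius M \<one> = x3"
proof -
  obtain p1 q1 where v1: "vec x1 = (p1, q1)" "p1 \<in> carrier R" "q1 \<in> carrier R"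
    using vec_closed[OF x(1)] by auto
  obtain p2 q2 where v2: "vec x2 = (p2, q2)" "p2 \<in> carrier R" "q2 \<in> carrier R"
    using vec_closed[OF x(2)] by auto
  obtain p3 q3 where v3: "vec x3 = (p3, q3)" "p3 \<in> carrier R" "q3 \<in> carrier R"
    using vec_closed[OF x(3)] by auto
  \<comment> \<open>Cramer's rule without division: these are the brackets \<open>[x3 x2]\<close>,
    \<open>[x1 x3]\<close> and \<open>[x1 x2]\<close>, nonzero because the points are
    distinct.\<close>
  define \<alpha> \<beta> \<gamma> where "\<alpha> = p3 \<otimes> q2 \<ominus> q3 \<otimes> p2" and "\<beta> = p1 \<otimes> q3 \<ominus> q1 \<otimes> p3"
    and "\<gamma> = p1 \<otimes> q2 \<ominus> q1 \<otimes> p2"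
  have nz: "\<alpha> \<noteq> \<zero>" "\<beta> \<noteq> \<zero>" "\<gamma> \<noteq> \<zero>"
    using det2_vec_eq_0_iff[OF x(3,2)] det2_vec_eq_0_iff[OF x(1,3)] det2_vec_eq_0_iff[OF x(1,2)] dist
    by (auto simp: v1 v2 v3 \<alpha>_def \<beta>_def \<gamma>_def det2_def)
  have cl: "\<alpha> \<in> carrier R" "\<beta> \<in> carrier R" "\<gamma> \<in> carrier R"
    using v1 v2 v3 by (auto simp: \<alpha>_def \<beta>_def \<gamma>_def)
  let ?M = "(\<alpha> \<otimes> p1, \<beta> \<otimes> p2, \<alpha> \<otimes> q1, \<beta> \<otimes> q2)"
  have "mat2_det R ?M = \<alpha> \<otimes> \<beta> \<otimes> \<gamma>"
    unfolding mat2_det_def \<gamma>_def using cl v1(2,3) v2(2,3) by (simp, algebra)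
  then have M: "?M \<in> carrier (GL2 R)"
    using cl nz v1 v2 by (simp add: carrier_GL2 integral_iff)
  have "\<alpha> \<otimes> p1 \<oplus> \<beta> \<otimes> p2 = \<gamma> \<otimes> p3" "\<alpha> \<otimes> q1 \<oplus> \<beta> \<otimes> q2 = \<gamma> \<otimes> q3"
    unfolding \<alpha>_def \<beta>_def \<gamma>_def using v1(2,3) v2(2,3) v3(2,3) by algebra+
  then have "moebius ?M \<omega> = x1" "moebius ?M \<zero> = x2" "moebius ?M \<one> = x3"
    using cl nz v1 v2 v3 x
      moebius_eqI[OF M, of \<omega> x1 \<alpha>] moebius_eqI[OF M, of \<zero> x2 \<beta>] moebius_eqI[OF M, of \<one> x3 \<gamma>]
    by (simp_all add: mat2_app_def smult2_def)
  then show thesis using that M by blast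
qed

end

section \<open>The hypergraph of a field of order 3 mod 4\<close>

locale paley_line = projective_line +
  assumes finite_carrier: "finite (carrier R)"
    and card_mod_4: "card (carrier R) mod 4 = 3"
begin

section \<open>The quadratic character\<close>

abbreviation "q \<equiv> card (carrier R)"

text \<open>Euler's criterion taken as the definition of a nonzero square (\<open>q div 2 = (q - 1) / 2\<close>).\<close>

definition residue :: "'a \<Rightarrow> bool" where
  "residue x \<longleftrightarrow> x [^] (q div 2) = \<one>"

definition arc :: "'a \<Rightarrow> 'a \<Rightarrow> bool" where
  "arc x y \<longleftrightarrow> residue (det2 R (vec x) (vec y))"

abbreviation "edges \<equiv> coherent_quads points arc"

text \<open>In characteristic 2 an odd multiple of 1 is 1, but \<open>q\<close> is odd and
  \<open>q\<close> times 1 is 0 by Lagrange's theorem.\<close>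

lemma minus_one_neq_one: "\<ominus> \<one> \<noteq> \<one>"
proof
  assume "\<ominus> \<one> = \<one>"
  then have two: "\<one> \<oplus> \<one> = \<zero>" using r_neg[OF one_closed] by simp
  have "[(2 * k)] \<cdot> \<one> = \<zero>" for k :: nat
    by (induction k) (simp_all add: a_assoc two)
  moreover have "q = Suc (2 * (q div 2))" using card_mod_4 by presburger
  ultimately have "[q] \<cdot> \<one> = \<one>"
    by (metis add.nat_pow_Suc l_zero one_closed)
  moreover have "[q] \<cdot> \<one> = \<zero>"
    using group.pow_order_eq_1[OF a_group, of \<one>] by (simp add: order_def add_pow_def)
  ultimately show False by simp
qed

text \<open>The square of this power is \<open>x [^] (q - 1)\<close>, which is 1 by Lagrange's
  theorem in the unit group, and in a field 1 has no square roots besides 1 and -1.\<close>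

lemma residue_cases:
  assumes x: "x \<in> carrier R" "x \<noteq> \<zero>"
  shows "x [^] (q div 2) = \<one> \<or> x [^] (q div 2) = \<ominus> \<one>"
proof -
  have "(x [^] (q div 2)) [^] (2::nat) = x [^] (q - 1)"
  proof -
    have "q div 2 * 2 = q - 1" using card_mod_4 by presburger
    then show ?thesis using x by (simp add: nat_pow_pow)
  qed
  also have "\<dots> = \<one>"
  proof -
    have "card (Units R) = q - 1" using finite_carrier by (simp add: field_Units)
    then show ?thesis
      using units_power_order_eq_one[of x] x finite_carrier by (simp add: field_Units)
  qed
  finally have "x [^] (q div 2) \<otimes> x [^] (q div 2) = \<one>"
    using x by (simp add: numeral_2_eq_2)
  then show ?thesis using x by (intro square_eq_one) auto
qed

text \<open>Equality of Booleans plays the role of the product of signs, here and in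
  \<open>coherent\<close>.\<close>

lemma residue_mult:
  assumes x: "x \<in> carrier R" "x \<noteq> \<zero>" and y: "y \<in> carrier R" "y \<noteq> \<zero>"
  shows "residue (x \<otimes> y) \<longleftrightarrow> (residue x \<longleftrightarrow> residue y)"
proof -
  have "(\<ominus> \<one>) \<otimes> (\<ominus> \<one>) = \<one>" by (simp add: l_minus)
  then show ?thesis
    using residue_cases[OF x] residue_cases[OF y] x y minus_one_neq_one
    unfolding residue_def by (auto simp: nat_pow_distrib)
qed

lemma residue_one: "residue \<one>"
  by (simp add: residue_def)

text \<open>Since \<open>q\<close> is 3 modulo 4, the exponent \<open>q div 2\<close> is odd, so -1
  is not a square. This makes \<open>arc\<close> antisymmetric.\<close>

lemma residue_minus:
  assumes x: "x \<in> carrier R" "x \<noteq> \<zero>"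
  shows "residue (\<ominus> x) \<longleftrightarrow> \<not> residue x"
proof -
  have "(\<ominus> \<one>) [^] (2 * k + 1) = \<ominus> \<one>" for k :: nat
    by (induction k) (simp_all add: l_minus r_minus m_assoc)
  moreover have "q div 2 = 2 * (q div 4) + 1" using card_mod_4 by presburger
  ultimately have "\<not> residue (\<ominus> \<one>)"
    using minus_one_neq_one by (simp add: residue_def)
  moreover have "\<ominus> \<one> \<noteq> \<zero>" by (metis minus_minus minus_zero one_closed one_not_zero)
  ultimately show ?thesis
    using residue_mult[of "\<ominus> \<one>" x] x by (simp add: l_minus)
qed

section \<open>The tournament, its automorphisms and the image of GL(2,q)\<close>

lemma finite_points: "finite points"
  by (simp add: points_def finite_carrier)

lemma card_points: "card points = q + 1"
  using omega_notin by (simp add: points_def finite_carrier)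

sublocale tournament points arc
proof
  fix x y assume xy: "x \<in> points" "y \<in> points" "x \<noteq> y"
  then show "arc y x \<longleftrightarrow> \<not> arc x y"
    unfolding arc_def
    by (subst det2_swap[of "vec x" "vec y"]) (simp_all add: residue_minus det2_vec_eq_0_iff)
qed (rule finite_points)

text \<open>Each of the three products contains each of the four points exactly once. Hence all
  three change by the character of \<open>s w\<close>, \<open>s x\<close>, \<open>s y\<close> and
  \<open>s z\<close> multiplied together, while the determinant enters squared.\<close>

lemma coherent_moebius:
  assumes M: "M \<in> carrier (GL2 R)"
    and V: "w \<in> points" "x \<in> points" "y \<in> points" "z \<in> points" and dist: "distinct [w, x, y, z]"
  shows "coherent arc (moebius M w) (moebius M x) (moebius M y) (moebius M z) \<longleftrightarrow> coherent arc w x y z"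
proof -
  obtain s where s: "\<And>x. x \<in> points \<Longrightarrow> s x \<in> carrier R \<and> s x \<noteq> \<zero>"
    "\<And>x y. \<lbrakk>x \<in> points; y \<in> points\<rbrakk> \<Longrightarrow> mat2_det R M \<otimes> det2 R (vec x) (vec y)
        = s x \<otimes> s y \<otimes> det2 R (vec (moebius M x)) (vec (moebius M y))"
    using det2_vec_moebius[OF M] by blast
  have arc: "arc (moebius M x) (moebius M y) \<longleftrightarrow>
      (arc x y \<longleftrightarrow> (residue (mat2_det R M) \<longleftrightarrow> (residue (s x) \<longleftrightarrow> residue (s y))))"
    if x: "x \<in> points" and y: "y \<in> points" and "x \<noteq> y" for x y
  proof -
    let ?d = "det2 R (vec x) (vec y)" and ?e = "det2 R (vec (moebius M x)) (vec (moebius M y))"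
    have cl: "mat2_det R M \<in> carrier R" "mat2_det R M \<noteq> \<zero>" "?d \<in> carrier R" "?d \<noteq> \<zero>"
      "?e \<in> carrier R" "?e \<noteq> \<zero>"
      using M x y \<open>x \<noteq> y\<close> moebius_closed[OF M] inj_on_moebius[OF M]
      by (auto simp: carrier_GL2 det2_vec_eq_0_iff inj_on_eq_iff)
    have "residue (mat2_det R M \<otimes> ?d) \<longleftrightarrow> residue (s x \<otimes> s y \<otimes> ?e)"
      by (simp only: s(2)[OF x y])
    then show ?thesis
      using cl s(1)[OF x] s(1)[OF y] unfolding arc_def
      by (simp add: residue_mult integral_iff) blast
  qed
  \<comment> \<open>\<open>coherent\<close> contains this pair in the order \<open>z\<close>,
    \<open>x\<close>, and the rule \<open>arc\<close> needs the inequality in that order.\<close>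
  have "z \<noteq> x" using dist by auto
  then show ?thesis
    using V dist unfolding coherent_def by (simp add: arc) blast
qed

lemma image_moebius_edges_iff:
  assumes M: "M \<in> carrier (GL2 R)" and A: "A \<subseteq> points"
  shows "moebius M ` A \<in> edges \<longleftrightarrow> A \<in> edges"
proof (cases "card A = 4")
  case True
  then have "finite A" using card.infinite by fastforce
  then obtain xs where "set xs = A" "distinct xs" using finite_distinct_list by blast
  moreover from this have "length xs = 4" using True distinct_card by force
  ultimately obtain w x y z where A_eq: "A = {w, x, y, z}" and dist: "distinct [w, x, y, z]"
    by (auto simp: numeral_eq_Suc length_Suc_conv)
  have V: "w \<in> points" "x \<in> points" "y \<in> points" "z \<in> points" using A A_eq by auto
  have "distinct [moebius M w, moebius M x, moebius M y, moebius M z]"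
    using dist V inj_on_moebius[OF M] by (simp add: inj_on_eq_iff)
  then show ?thesis
    unfolding A_eq using V dist coherent_quads_iff coherent_moebius[OF M V dist] moebius_closed[OF M]
    by simp
next
  case False
  have "card (moebius M ` A) = card A"
    using inj_on_subset[OF inj_on_moebius[OF M] A] by (rule card_image)
  then show ?thesis using False coherent_quadsD(2) by metis
qed

lemma moebius_Bij:
  assumes M: "M \<in> carrier (GL2 R)"
  shows "moebius M \<in> Bij points"
proof -
  have "moebius M ` points = points"
    using endo_inj_surj[OF finite_points _ inj_on_moebius[OF M]] moebius_closed[OF M] by blast
  then show ?thesis
    using inj_on_moebius[OF M] by (simp add: Bij_def bij_betw_def moebius_def extensional_restrict)
qed

lemma moebius_auts: "M \<in> carrier (GL2 R) \<Longrightarrow> moebius M \<in> hypergraph_auts points edges"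
  by (simp add: hypergraph_auts_def moebius_Bij image_moebius_edges_iff)

lemma moebius_group_hom: "group_hom (GL2 R) (hypergraph_aut_group points edges) moebius"
proof (intro group_hom.intro group_hom_axioms.intro group_GL2 group_hypergraph_aut_group homI)
  show "moebius M \<in> carrier (hypergraph_aut_group points edges)" if "M \<in> carrier (GL2 R)" for M
    using moebius_auts[OF that] by (simp add: hypergraph_aut_group_def)
  show "moebius (M \<otimes>\<^bsub>GL2 R\<^esub> N)
      = moebius M \<otimes>\<^bsub>hypergraph_aut_group points edges\<^esub> moebius N"
    if "M \<in> carrier (GL2 R)" "N \<in> carrier (GL2 R)" for M N
    using that by (simp add: hypergraph_aut_group_def BijGroup_def moebius_Bij mult_GL2 moebius_mult)
qed

text \<open>Both triples are images of (\<omega>, 0, 1), so one goes to the other by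
  \<open>N\<close> after the inverse of \<open>M\<close>.\<close>

lemma three_transitive_edges: "three_transitive points edges"
proof -
  interpret hom: group_hom "GL2 R" "hypergraph_aut_group points edges" moebius
    by (rule moebius_group_hom)
  have "\<exists>f\<in>hypergraph_auts points edges. f x1 = y1 \<and> f x2 = y2 \<and> f x3 = y3"
    if x: "x1 \<in> points" "x2 \<in> points" "x3 \<in> points" "distinct [x1, x2, x3]"
      and y: "y1 \<in> points" "y2 \<in> points" "y3 \<in> points" "distinct [y1, y2, y3]"
    for x1 x2 x3 y1 y2 y3
  proof -
    obtain M where M: "M \<in> carrier (GL2 R)" "moebius M \<omega> = x1" "moebius M \<zero> = x2" "moebius M \<one> = x3"
      using ex_moebius_triple[OF x] by blast
    obtain N where N: "N \<in> carrier (GL2 R)" "moebius N \<omega> = y1" "moebius N \<zero> = y2" "moebius N \<one> = y3"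
      using ex_moebius_triple[OF y] by blast
    let ?L = "mat2_mult R N (inv\<^bsub>GL2 R\<^esub> M)"
    have L: "?L \<in> carrier (GL2 R)"
      using hom.G.m_closed[OF N(1) hom.G.inv_closed[OF M(1)]] by (simp add: mult_GL2)
    have "mat2_mult R ?L M = N"
      using hom.G.inv_solve_right'[of N M N] M(1) N(1) hom.G.m_assoc[of N "inv\<^bsub>GL2 R\<^esub> M" M]
      by (simp flip: mult_GL2)
    then have "moebius ?L (moebius M u) = moebius N u" if "u \<in> points" for u
      using moebius_mult[OF L M(1)] that by (simp add: compose_def)
    then show ?thesis
      using M N moebius_auts[OF L] by (intro bexI[of _ "moebius ?L"]) auto
  qed
  then show ?thesis unfolding three_transitive_def by blast
qed

lemma kernel_moebius:
  "kernel (GL2 R) (hypergraph_aut_group points edges) moebius = scalar_mats2 R"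
proof -
  have "scalar_mats2 R \<subseteq> carrier (GL2 R)"
    by (auto simp: scalar_mats2_def carrier_GL2 mat2_det_def minus_eq integral_iff)
  then show ?thesis
    unfolding kernel_def using moebius_eq_id_iff
    by (auto simp: hypergraph_aut_group_def BijGroup_def)
qed

text \<open>The first isomorphism theorem for \<open>moebius\<close>, whose kernel consists of the
  scalar matrices.\<close>

lemma subgroup_iso_PGL2:
  obtains K where "subgroup K (hypergraph_aut_group points edges)"
    and "(hypergraph_aut_group points edges) \<lparr>carrier := K\<rparr> \<cong> PGL2 R"
proof -
  let ?G = "hypergraph_aut_group points edges"
  interpret hom: group_hom "GL2 R" ?G moebius by (rule moebius_group_hom)
  let ?K = "moebius ` carrier (GL2 R)"
  have sub: "subgroup ?K ?G" by (rule hom.img_is_subgroup)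
  \<comment> \<open>Narrowing the codomain to the image makes the homomorphism surjective.\<close>
  have "group (?G\<lparr>carrier := ?K\<rparr>)"
    by (rule subgroup.subgroup_is_group[OF sub hom.H.is_group])
  moreover have "moebius \<in> hom (GL2 R) (?G\<lparr>carrier := ?K\<rparr>)"
    by (rule homI) simp_all
  ultimately interpret img: group_hom "GL2 R" "?G\<lparr>carrier := ?K\<rparr>" moebius
    by (intro group_hom.intro group_hom_axioms.intro group_GL2)
  have "kernel (GL2 R) (?G\<lparr>carrier := ?K\<rparr>) moebius = scalar_mats2 R"
    using kernel_moebius by (simp add: kernel_def)
  then have "PGL2 R \<cong> ?G\<lparr>carrier := ?K\<rparr>"
    using img.FactGroup_iso_set unfolding PGL2_def is_iso_def by auto
  then have "?G\<lparr>carrier := ?K\<rparr> \<cong> PGL2 R"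
    using group.iso_sym normal.factorgroup_is_group[OF hom.normal_kernel]
    unfolding kernel_moebius PGL2_def by blast
  then show thesis using that sub by blast
qed

section \<open>Counting hyperedges\<close>

definition base_block :: "'a set" where
  "base_block = {x \<in> carrier R - {\<zero>, \<one>}. \<not> residue x \<and> \<not> residue (\<one> \<ominus> x)}"

text \<open>The three products for \<omega>, 0, 1, \<open>x\<close> have the signs of
  \<open>1 - x\<close>, \<open>x\<close> and -1. They agree exactly when the first two are negative
  as well.\<close>

lemma base_edge_iff:
  assumes x: "x \<in> points" "x \<notin> {\<omega>, \<zero>, \<one>}"
  shows "{\<omega>, \<zero>, \<one>, x} \<in> edges \<longleftrightarrow> x \<in> base_block"
proof -
  have xc: "x \<in> carrier R" "x \<noteq> \<zero>" "x \<noteq> \<one>" using x by (auto simp: points_def)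
  have "arc \<omega> \<zero>" "arc \<omega> \<one>" "arc \<omega> x" "\<not> arc \<zero> \<one>" "arc x \<zero> \<longleftrightarrow> residue x"
      "arc \<one> x \<longleftrightarrow> residue (\<one> \<ominus> x)"
    using xc residue_minus[of \<one>] residue_one
    by (simp_all add: arc_def det2_def minus_eq)
  then have "coherent arc \<omega> \<zero> \<one> x \<longleftrightarrow> \<not> residue x \<and> \<not> residue (\<one> \<ominus> x)"
    unfolding coherent_def by auto
  moreover have "distinct [\<omega>, \<zero>, \<one>, x]"
    using xc x carrier_neq_omega[of \<zero>] carrier_neq_omega[of \<one>] by auto
  ultimately show ?thesis
    using coherent_quads_iff[of \<omega> \<zero> \<one> x] x xc by (simp add: base_block_def)
qed

text \<open>Classify \<open>x \<noteq> 0, 1\<close> by the characters of \<open>x\<close> and \<open>1 - x\<close>: the maps \<open>x \<mapsto> 1 - x\<close> and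
  \<open>x \<mapsto> 1/x\<close> permute the three classes other than \<open>base_block\<close>, which therefore have equal size.\<close>

lemma card_base_block: "card base_block = (q + 1) div 4"
proof -
  let ?U = "carrier R - {\<zero>, \<one>}"
  let ?c = "\<lambda>a b. {x \<in> ?U. residue x = a \<and> residue (\<one> \<ominus> x) = b}"
  have one_minus: "\<one> \<ominus> x \<in> ?U \<and> \<one> \<ominus> (\<one> \<ominus> x) = x" if "x \<in> ?U" for x
  proof -
    have x: "x \<in> carrier R" "x \<noteq> \<zero>" "x \<noteq> \<one>" using that by auto
    have inv: "\<one> \<ominus> (\<one> \<ominus> x) = x" using x(1) by algebra
    have "\<one> \<ominus> x \<noteq> \<zero>" using x by simp
    moreover have "\<one> \<ominus> x \<noteq> \<one>" using inv x by auto
    ultimately show ?thesis using x inv by simp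
  qed
  have swap: "card (?c a b) = card (?c b a)" for a b
  proof (rule bij_betw_same_card)
    show "bij_betw (\<lambda>x. \<one> \<ominus> x) (?c a b) (?c b a)"
      by (rule bij_betw_byWitness[where f' = "\<lambda>x. \<one> \<ominus> x"]) (use one_minus in auto)
  qed
  have invert: "inv x \<in> ?U \<and> inv (inv x) = x \<and> (residue (inv x) \<longleftrightarrow> residue x) \<and>
      (residue (\<one> \<ominus> inv x) \<longleftrightarrow> (residue x \<longleftrightarrow> \<not> residue (\<one> \<ominus> x)))" if "x \<in> ?U" for x
  proof -
    have x: "x \<in> carrier R" "x \<noteq> \<zero>" "x \<noteq> \<one>" "x \<in> Units R" using that by (auto simp: field_Units)
    have inv: "inv x \<in> carrier R" "inv x \<noteq> \<zero>" "x \<otimes> inv x = \<one>" "inv (inv x) = x"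
      using x Units_inv_Units[of x] by (auto simp: field_Units)
    have neq: "inv x \<noteq> \<one>" using x(1,3) inv(3) r_one by metis
    have 1: "residue (inv x) \<longleftrightarrow> residue x"
      using residue_mult[of x "inv x"] x inv residue_one by simp
    \<comment> \<open>By this identity the character of \<open>1 - 1/x\<close> is minus the product
      of those of \<open>x\<close> and \<open>1 - x\<close>. For a square \<open>x\<close>,
      inversion therefore reverses the character of \<open>1 - x\<close>.\<close>
    have "x \<otimes> (\<one> \<ominus> inv x) = \<ominus> (\<one> \<ominus> x)"
    proof -
      have "x \<otimes> (\<one> \<ominus> inv x) = x \<ominus> x \<otimes> inv x" using x(1) inv(1) by algebra
      also have "\<dots> = \<ominus> (\<one> \<ominus> x)" unfolding inv(3) using x(1) by algebra
      finally show ?thesis .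
    qed
    then have "(residue x \<longleftrightarrow> residue (\<one> \<ominus> inv x)) \<longleftrightarrow> \<not> residue (\<one> \<ominus> x)"
      using residue_mult[of x "\<one> \<ominus> inv x"] residue_minus[of "\<one> \<ominus> x"] x inv neq by simp
    then show ?thesis using x inv neq 1 by auto
  qed
  have inv_swap: "card (?c True True) = card (?c True False)"
  proof (rule bij_betw_same_card)
    show "bij_betw (\<lambda>x. inv x) (?c True True) (?c True False)"
      by (rule bij_betw_byWitness[where f' = "\<lambda>x. inv x"]) (use invert in auto)
  qed
  have finU: "finite ?U" using finite_carrier by simp
  \<comment> \<open>Negation exchanges nonzero squares and nonsquares.\<close>
  have res: "card {x \<in> carrier R - {\<zero>}. residue x} = card {x \<in> carrier R - {\<zero>}. \<not> residue x}"
  proof (rule bij_betw_same_card)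
    have "\<ominus> x \<noteq> \<zero>" if "x \<in> carrier R" "x \<noteq> \<zero>" for x
      using that by (metis minus_minus minus_zero)
    then show "bij_betw (\<lambda>x. \<ominus> x) {x \<in> carrier R - {\<zero>}. residue x} {x \<in> carrier R - {\<zero>}. \<not> residue x}"
      by (intro bij_betw_byWitness[where f' = "\<lambda>x. \<ominus> x"]) (auto simp: residue_minus)
  qed
  have "card {x \<in> carrier R - {\<zero>}. residue x} + card {x \<in> carrier R - {\<zero>}. \<not> residue x} = q - 1"
  proof -
    have split: "{x \<in> carrier R - {\<zero>}. residue x} \<union> {x \<in> carrier R - {\<zero>}. \<not> residue x}
        = carrier R - {\<zero>}"
      by blast
    show ?thesis
      using finite_carrier card_Un_disjoint[of "{x \<in> carrier R - {\<zero>}. residue x}"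
          "{x \<in> carrier R - {\<zero>}. \<not> residue x}"]
      unfolding split by fastforce
  qed
  \<comment> \<open>The element 1 is a square outside \<open>?U\<close>; it accounts for the extra 1
    in the count.\<close>
  moreover have "{x \<in> carrier R - {\<zero>}. residue x} = insert \<one> (?c True True \<union> ?c True False)"
    using residue_one by auto
  then have "card {x \<in> carrier R - {\<zero>}. residue x} = Suc (card (?c True True) + card (?c True False))"
    using finU by (simp add: card_insert_disjoint) (subst card_Un_disjoint, auto)
  moreover have "{x \<in> carrier R - {\<zero>}. \<not> residue x} = ?c False True \<union> ?c False False"
    using residue_one by auto
  then have "card {x \<in> carrier R - {\<zero>}. \<not> residue x} = card (?c False True) + card (?c False False)"
    using finU by (simp, subst card_Un_disjoint) auto
  moreover have "card (?c False False) = card base_block"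
    by (rule arg_cong[where f = card]) (auto simp: base_block_def)
  moreover have "q > 1" using card_mod_4 by (cases q) auto
  \<comment> \<open>Let n be the common size of the other three classes and B that of
    \<open>base_block\<close>. There are 2n + 1 squares and n + B nonsquares, both equal to (q -
    1)/2, so n = (q - 3)/4 and B = n + 1.\<close>
  ultimately have "4 * card base_block = q + 1"
    using res swap[of True False] inv_swap by linarith
  then show ?thesis by simp
qed

text \<open>A Moebius map carries \<omega>, 0, 1 to the given triple and preserves hyperedges, so
  the possible fourth vertices are the images of \<open>base_block\<close>.\<close>

lemma card_edges_containing:
  assumes T: "T \<subseteq> points" "card T = 3"
  shows "card {A \<in> edges. T \<subseteq> A} = (q + 1) div 4"
proof -
  obtain x1 x2 x3 where T_eq: "T = {x1, x2, x3}" and dist: "distinct [x1, x2, x3]"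
    using T(2) by (auto simp: card_3_iff)
  then have x: "x1 \<in> points" "x2 \<in> points" "x3 \<in> points" using T(1) by auto
  obtain M where M: "M \<in> carrier (GL2 R)"
    and Mx: "moebius M \<omega> = x1" "moebius M \<zero> = x2" "moebius M \<one> = x3"
    using ex_moebius_triple[OF x dist] by blast
  let ?f = "moebius M"
  have base: "{\<omega>, \<zero>, \<one>} \<subseteq> points" by simp
  have fT: "?f ` {\<omega>, \<zero>, \<one>} = T" using Mx T_eq by simp
  have inj: "inj_on ?f points" by (rule inj_on_moebius[OF M])
  have surj: "?f ` points = points" using moebius_Bij[OF M] by (simp add: Bij_def bij_betw_def)
  have bb: "x \<in> points \<and> x \<notin> {\<omega>, \<zero>, \<one>}" if "x \<in> base_block" for x
    using that carrier_neq_omega by (auto simp: base_block_def)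
  have edge_iff: "insert (?f x) T \<in> edges \<longleftrightarrow> x \<in> base_block"
    if x: "x \<in> points" "x \<notin> {\<omega>, \<zero>, \<one>}" for x
  proof -
    have "insert (?f x) T = ?f ` {\<omega>, \<zero>, \<one>, x}" using Mx T_eq by auto
    then show ?thesis
      using image_moebius_edges_iff[OF M, of "{\<omega>, \<zero>, \<one>, x}"] base_edge_iff[OF x] x by simp
  qed
  have notin: "?f x \<notin> T" if "x \<in> points" "x \<notin> {\<omega>, \<zero>, \<one>}" for x
    using that inj base unfolding fT[symmetric] by (auto dest: inj_onD)
  have "bij_betw (\<lambda>x. insert (?f x) T) base_block {A \<in> edges. T \<subseteq> A}"
  proof (rule bij_betwI')
    fix x y assume x: "x \<in> base_block" and y: "y \<in> base_block"
    have "?f x = ?f y" if "insert (?f x) T = insert (?f y) T"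
      using that notin bb[OF x] bb[OF y] by blast
    then show "insert (?f x) T = insert (?f y) T \<longleftrightarrow> x = y"
      using inj bb[OF x] bb[OF y] by (auto dest: inj_onD)
  next
    fix x assume "x \<in> base_block"
    then show "insert (?f x) T \<in> {A \<in> edges. T \<subseteq> A}"
      using edge_iff bb by blast
  next
    fix A assume A: "A \<in> {A \<in> edges. T \<subseteq> A}"
    have finT: "finite T" using T(2) card.infinite by fastforce
    have "card (A - T) = 1"
      using A T(2) finT coherent_quadsD(2)[of A] by (simp add: card_Diff_subset)
    then obtain u where u: "A - T = {u}" by (auto simp: card_1_singleton_iff)
    then have A_eq: "A = insert u T" using A by auto
    have "u \<in> points" using u A coherent_quadsD(1)[of A] by auto
    then obtain x where x: "x \<in> points" "u = ?f x" using surj by blast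
    have "x \<notin> {\<omega>, \<zero>, \<one>}" using u x fT by blast
    then show "\<exists>x\<in>base_block. A = insert (?f x) T"
      using edge_iff[of x] x A A_eq by auto
  qed
  from bij_betw_same_card[OF this] show ?thesis using card_base_block by simp
qed

lemma design_edges: "design 3 (q + 1) 4 ((q + 1) div 4) points edges"
  unfolding design_def
  using uniform_coherent_quads card_points card_edges_containing by simp

text \<open>Double counting with triples gives four times the number of hyperedges; a further factor
  4 clears the denominator of the design parameter, as \<open>q + 1\<close> is divisible by
  4.\<close>

lemma card_edges: "16 * card edges = (q + 1) * ((q + 1) choose 3)"
proof -
  have "card edges * (4 choose 3) = (q + 1) div 4 * (card points choose 3)"
    using finite_points coherent_quadsD card_edges_containing
    by (intro sum_card_supersets) auto
  moreover have "(4 choose 3) = (4::nat)" by (simp add: numeral_eq_Suc)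
  ultimately have "16 * card edges = 4 * ((q + 1) div 4) * ((q + 1) choose 3)"
    by (simp add: card_points mult.commute)
  also have "4 * ((q + 1) div 4) = q + 1" using card_mod_4 by presburger
  finally show ?thesis .
qed

end

theorem theorem1p1:
  fixes q :: nat
  assumes "primepow q" and "q mod 4 = 3"
  shows "\<exists>(V :: nat set) (E :: nat set set).
    design 3 (q + 1) 4 ((q + 1) div 4) V E \<and>
    (\<forall>S. S \<subseteq> V \<and> card S = 5 \<longrightarrow> card (spanned_hyperedges E S) \<in> {0, 2}) \<and>
    real (card E) = (real q + 1) / 16 * real ((q + 1) choose 3) \<and>
    three_transitive V E \<and>
    has_subgroup_iso_PGL2 (hypergraph_aut_group V E) q"
proof -
  obtain F :: "nat ring" where F: "field F" "finite (carrier F)" "card (carrier F) = q"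
    using exists_finite_field[OF assms(1)] by blast
  \<comment> \<open>A finite set of natural numbers misses some number, which becomes the point at
    infinity.\<close>
  obtain \<omega> where \<omega>: "\<omega> \<notin> carrier F" using ex_new_if_finite[OF infinite_UNIV_nat F(2)] by blast
  interpret field F by (rule F(1))
  interpret paley_line F \<omega>
    by unfold_locales (use F \<omega> assms in auto)
  have "16 * real (card edges) = (real q + 1) * real ((q + 1) choose 3)"
    using arg_cong[OF card_edges, of real] unfolding F(3) by (simp add: algebra_simps)
  moreover have "has_subgroup_iso_PGL2 (hypergraph_aut_group points edges) q"
    unfolding has_subgroup_iso_PGL2_def using F subgroup_iso_PGL2 by metis
  ultimately show ?thesis
    using design_edges card_spanned_coherent_quads three_transitive_edges unfolding F(3)
    by (intro exI[of _ points] exI[of _ edges]) auto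
qed

end
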